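(* Let $(K,<)$ be an ordered field and let $(\mathcal F,\int)$ be an ordinary shifted Rota-Baxter algebra over $K$. Then the piecewise extension $(\mathcal P\mathcal F,\int)$ (with the Rota-Baxter operator, shifts $S_c$ and evaluation $\mathsf e$ on $\mathcal P\mathcal F$ defined in the context) is a shifted Rota-Baxter algebra extending $(\mathcal F,\int)$.
   Context: All algebras are commutative and unital; $[P,Q]=PQ-QP$ denotes the commutator of linear operators. **Heaviside operator.** $H\colon K\to K$ is $H(a)=0$ for $a\le 0$ and $H(a)=1$ for $a>0$; $\bar H(a)=1-H(a)$. Write $a\sqcup b=\max(a,b)$. **Rota-Baxter algebras.** A Rota-Baxter algebra $(\mathcal F,\int)$ over $K$ is a $K$-algebra with a $K$-linear map $\int\colon\mathcal F\to\mathcal F$ satisfying $(\int f)(\int g)=\int(f\int g)+\int(g\int f)$. A character is a $K$-algebra homomorphism $\mathcal F\to K$; an evaluation on $(\mathcal F,\int)$ is a character $\mathsf e$ with $\mathsf e\circ\int=0$. $(\mathcal F,\int)$ is ordinary if $\int$ is injective and $\mathcal F=\operatorname{Im}(\int)\oplus K$ as $K$-vector spaces; then the projector $\mathsf e$ onto $K$ along $\operatorname{Im}(\int)$ is an evaluation, which is the one used. **Shifts.** A shift map on a $K$-algebra $\mathcal F$ is a group homomorphism $S\colon(K,+)\to\operatorname{Aut}_K(\mathcal F)$, $c\mapsto S_c$. A shifted Rota-Baxter algebra is a Rota-Baxter algebra $(\mathcal F,\int)$ with an evaluation $\mathsf e$ and a shift map $S$ such that $[S_c,\int]=\mathsf e_c\circ\int$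 for all $c\in K$, where $\mathsf e_c:=\mathsf e\circ S_c$. Set $\int_c:=(1-\mathsf e_c)\int$ and $\int_c^d:=\mathsf e_d\int_c$ (a $K$-valued functional). **Piecewise extension.** $\mathcal P\mathcal F$ is the monoid algebra over $\mathcal F$ of the semigroup $(K,\sqcup)$ with an identity adjoined: it is the free $\mathcal F$-module on $1$ and $H_a$ $(a\in K)$ with $H_aH_b=H_{a\sqcup b}$. Put $\bar H_a:=1-H_a$. The operator $\int$ on $\mathcal P\mathcal F$ is the $K$-linear extension of $\int$ on $\mathcal F$ with $$\int fH_a=\Big(\int_a f\Big)H_a+\bar H(a)\int_0^a f\qquad(f\in\mathcal F,\ a\in K).$$ The shifts on $\mathcal P\mathcal F$ are the algebra homomorphisms extending $S_c$ on $\mathcal F$ with $S_c(H_a)=H_{a-c}$, and $\mathsf e\colon\mathcal P\mathcal F\to K$ is the character extending $\mathsf e$ on $\mathcal F$ with $\mathsf e(H_a)=\bar H(a)$. *)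

theory Defs
  imports Complex_Main "HOL-Library.Poly_Mapping"
begin

section \<open>Commutative algebras and characters\<close>

locale comm_algebra = vector_space scale
  for scale :: "'k::field \<Rightarrow> 'f::comm_ring_1 \<Rightarrow> 'f" +
  assumes scale_mult_left: "scale c x * y = scale c (x * y)"

locale algebra_hom =
  source: comm_algebra scale1 +
  target: comm_algebra scale2 +
  Vector_Spaces.linear scale1 scale2 h
  for scale1 :: "'k::field \<Rightarrow> 'f::comm_ring_1 \<Rightarrow> 'f"
    and scale2 :: "'k \<Rightarrow> 'g::comm_ring_1 \<Rightarrow> 'g"
    and h :: "'f \<Rightarrow> 'g" +
  assumes hom_mult: "h (x * y) = h x * h y"
    and hom_one: "h 1 = 1"

locale algebra_automorphism = algebra_hom scale scale h
  for scale :: "'k::field \<Rightarrow> 'f::comm_ring_1 \<Rightarrow> 'f" and h :: "'f \<Rightarrow> 'f" +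
  assumes bij: "bij h"

locale character = algebra_hom scale "(*)" \<chi>
  for scale :: "'k::field \<Rightarrow> 'f::comm_ring_1 \<Rightarrow> 'f" and \<chi> :: "'f \<Rightarrow> 'k"


section \<open>Shifted Rota-Baxter algebras\<close>

locale rota_baxter =
  comm_algebra scale +
  Vector_Spaces.linear scale scale I
  for scale :: "'k::field \<Rightarrow> 'f::comm_ring_1 \<Rightarrow> 'f" and I :: "'f \<Rightarrow> 'f" +
  assumes rota_baxter: "I f * I g = I (f * I g) + I (g * I f)"

locale rb_evaluation = rota_baxter scale I + character scale e
  for scale :: "'k::field \<Rightarrow> 'f::comm_ring_1 \<Rightarrow> 'f"
    and I :: "'f \<Rightarrow> 'f" and e :: "'f \<Rightarrow> 'k" +
  assumes eval_integral: "e (I f) = 0"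

locale ordinary_rota_baxter = rota_baxter scale I
  for scale :: "'k::field \<Rightarrow> 'f::comm_ring_1 \<Rightarrow> 'f" and I :: "'f \<Rightarrow> 'f" +
  assumes inj_integral: "inj I"
    and range_Int_constants: "range I \<inter> range (\<lambda>c. scale c 1) = {0}"
    and range_plus_constants: "\<exists>g c. f = I g + scale c 1"

text \<open>The projector onto the constants along the range of \<open>I\<close>; it is only
  meaningful if the algebra is the direct sum of the two.\<close>

definition ordinary_eval ::
  "('k::field \<Rightarrow> 'f::comm_ring_1 \<Rightarrow> 'f) \<Rightarrow> ('f \<Rightarrow> 'f) \<Rightarrow> 'f \<Rightarrow> 'k" where
  "ordinary_eval scale I f = (THE c. \<exists>g. f = I g + scale c 1)"

locale shift_map = comm_algebra scale
  for scale :: "'k::field \<Rightarrow> 'f::comm_ring_1 \<Rightarrow> 'f" and S :: "'k \<Rightarrow> 'f \<Rightarrow> 'f" +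
  assumes shift_automorphism: "algebra_automorphism scale (S c)"
    and shift_add: "S (c + d) = S c \<circ> S d"

definition eval_at :: "('f \<Rightarrow> 'k) \<Rightarrow> ('k \<Rightarrow> 'f \<Rightarrow> 'f) \<Rightarrow> 'k \<Rightarrow> 'f \<Rightarrow> 'k" where
  "eval_at e S c = e \<circ> S c"

locale shifted_rota_baxter = rb_evaluation scale I e + shift_map scale S
  for scale :: "'k::field \<Rightarrow> 'f::comm_ring_1 \<Rightarrow> 'f"
    and I :: "'f \<Rightarrow> 'f" and e :: "'f \<Rightarrow> 'k" and S :: "'k \<Rightarrow> 'f \<Rightarrow> 'f" +
  assumes shift_commutator: "S c (I f) - I (S c f) = scale (eval_at e S c (I f)) 1"

definition integral_from ::
  "('k::field \<Rightarrow> 'f::comm_ring_1 \<Rightarrow> 'f) \<Rightarrow> ('f \<Rightarrow> 'f) \<Rightarrow> ('f \<Rightarrow> 'k) \<Rightarrow> ('k \<Rightarrow> 'f \<Rightarrow> 'f) \<Rightarrow>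
   'k \<Rightarrow> 'f \<Rightarrow> 'f" where
  "integral_from scale I e S c f = I f - scale (eval_at e S c (I f)) 1"

definition integral_from_to ::
  "('k::field \<Rightarrow> 'f::comm_ring_1 \<Rightarrow> 'f) \<Rightarrow> ('f \<Rightarrow> 'f) \<Rightarrow> ('f \<Rightarrow> 'k) \<Rightarrow> ('k \<Rightarrow> 'f \<Rightarrow> 'f) \<Rightarrow>
   'k \<Rightarrow> 'k \<Rightarrow> 'f \<Rightarrow> 'k" where
  "integral_from_to scale I e S c d f = eval_at e S d (integral_from scale I e S c f)"

locale shifted_rota_baxter_extension =
  base: shifted_rota_baxter scale I e S +
  ext: shifted_rota_baxter scale' I' e' S' +
  algebra_hom scale scale' \<iota>
  for scale :: "'k::field \<Rightarrow> 'f::comm_ring_1 \<Rightarrow> 'f"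
    and I :: "'f \<Rightarrow> 'f" and e :: "'f \<Rightarrow> 'k" and S :: "'k \<Rightarrow> 'f \<Rightarrow> 'f"
    and scale' :: "'k \<Rightarrow> 'g::comm_ring_1 \<Rightarrow> 'g"
    and I' :: "'g \<Rightarrow> 'g" and e' :: "'g \<Rightarrow> 'k" and S' :: "'k \<Rightarrow> 'g \<Rightarrow> 'g"
    and \<iota> :: "'f \<Rightarrow> 'g" +
  assumes inj_embedding: "inj \<iota>"
    and integral_embedding: "I' (\<iota> f) = \<iota> (I f)"
    and eval_embedding: "e' (\<iota> f) = e f"
    and shift_embedding: "S' c (\<iota> f) = \<iota> (S c f)"


section \<open>The piecewise extension\<close>

definition heaviside :: "'k::linordered_field \<Rightarrow> 'k" where
  "heaviside a = (if a \<le> 0 then 0 else 1)"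

definition heaviside_bar :: "'k::linordered_field \<Rightarrow> 'k" where
  "heaviside_bar a = 1 - heaviside a"

text \<open>The semigroup \<open>('k, max)\<close> with an identity adjoined. It is written additively,
  because the product of \<^typ>\<open>'m \<Rightarrow>\<^sub>0 'f\<close> is convolution over an additive monoid.\<close>

datatype 'k pw_index = Identity | Step 'k

instantiation pw_index :: (linorder) comm_monoid_add
begin

definition zero_pw_index :: "'a pw_index" where
  "0 = Identity"

fun plus_pw_index :: "'a pw_index \<Rightarrow> 'a pw_index \<Rightarrow> 'a pw_index" where
  "Identity + n = n"
| "m + Identity = m"
| "Step a + Step b = Step (max a b)"

instance
proof
  fix a b c :: "'a pw_index"
  show "a + b + c = a + (b + c)"
    by (cases a; cases b; cases c) (simp_all add: max.assoc)
  show "a + b = b + a"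
    by (cases a; cases b) (simp_all add: max.commute)
  show "0 + a = a"
    by (simp add: zero_pw_index_def)
qed

end

type_synonym ('k, 'f) piecewise = "'k pw_index \<Rightarrow>\<^sub>0 'f"

definition pw_scale ::
  "('k::linorder \<Rightarrow> 'f::comm_ring_1 \<Rightarrow> 'f) \<Rightarrow> 'k \<Rightarrow> ('k, 'f) piecewise \<Rightarrow> ('k, 'f) piecewise" where
  "pw_scale scale c = Poly_Mapping.map (scale c)"

definition pw_embed :: "'f::comm_ring_1 \<Rightarrow> ('k::linorder, 'f) piecewise" where
  "pw_embed f = Poly_Mapping.single 0 f"

definition pw_step :: "'k::linorder \<Rightarrow> ('k, 'f::comm_ring_1) piecewise" where
  "pw_step a = Poly_Mapping.single (Step a) 1"

text \<open>The additive map on the piecewise extension with \<open>f \<mapsto> u f\<close> and \<open>f H\<^sub>a \<mapsto> v a f\<close>,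
  for additive \<open>u\<close> and \<open>v a\<close>.\<close>

definition pw_extend ::
  "('f::comm_ring_1 \<Rightarrow> 'b::comm_monoid_add) \<Rightarrow> ('k \<Rightarrow> 'f \<Rightarrow> 'b) \<Rightarrow> ('k, 'f) piecewise \<Rightarrow> 'b" where
  "pw_extend u v p =
     (\<Sum>m\<in>Poly_Mapping.keys p.
        case m of
          Identity \<Rightarrow> u (Poly_Mapping.lookup p m)
        | Step a \<Rightarrow> v a (Poly_Mapping.lookup p m))"

definition pw_integral ::
  "('k::linordered_field \<Rightarrow> 'f::comm_ring_1 \<Rightarrow> 'f) \<Rightarrow> ('f \<Rightarrow> 'f) \<Rightarrow> ('f \<Rightarrow> 'k) \<Rightarrow>
   ('k \<Rightarrow> 'f \<Rightarrow> 'f) \<Rightarrow> ('k, 'f) piecewise \<Rightarrow> ('k, 'f) piecewise" where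
  "pw_integral scale I e S =
     pw_extend
       (\<lambda>f. pw_embed (I f))
       (\<lambda>a f. pw_embed (integral_from scale I e S a f) * pw_step a
            + pw_scale scale (heaviside_bar a * integral_from_to scale I e S 0 a f) 1)"

definition pw_shift ::
  "('k::linordered_field \<Rightarrow> 'f::comm_ring_1 \<Rightarrow> 'f) \<Rightarrow>
   'k \<Rightarrow> ('k, 'f) piecewise \<Rightarrow> ('k, 'f) piecewise" where
  "pw_shift S c =
     pw_extend (\<lambda>f. pw_embed (S c f)) (\<lambda>a f. pw_embed (S c f) * pw_step (a - c))"

definition pw_eval ::
  "('f::comm_ring_1 \<Rightarrow> 'k::linordered_field) \<Rightarrow> ('k, 'f) piecewise \<Rightarrow> 'k" where
  "pw_eval e = pw_extend e (\<lambda>a f. e f * heaviside_bar a)"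

lemma pw_step_mult: "pw_step a * pw_step b = pw_step (max a b)"
  by (simp add: pw_step_def mult_single)

lemma pw_embed_mult_step: "pw_embed f * pw_step a = Poly_Mapping.single (Step a) f"
  by (simp add: pw_step_def pw_embed_def mult_single)

lemma pw_extend_embed: "u 0 = 0 \<Longrightarrow> pw_extend u v (pw_embed f) = u f"
  by (simp add: pw_extend_def pw_embed_def zero_pw_index_def)

lemma pw_extend_mult_step: "v a 0 = 0 \<Longrightarrow> pw_extend u v (pw_embed f * pw_step a) = v a f"
  by (simp add: pw_extend_def pw_embed_mult_step)

lemma pw_extend_add:
  assumes u: "u 0 = 0" "\<And>f g. u (f + g) = u f + u g"
    and v: "\<And>a. v a 0 = 0" "\<And>a f g. v a (f + g) = v a f + v a g"
  shows "pw_extend u v (p + q) = pw_extend u v p + pw_extend u v q"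
proof -
  define w where "w m f = (case m of Identity \<Rightarrow> u f | Step a \<Rightarrow> v a f)" for m f
  have w0: "w m 0 = 0" and w_add: "w m (f + g) = w m f + w m g" for m f g
    using u v by (cases m; simp add: w_def)+
  have ext: "pw_extend u v r = (\<Sum>m\<in>A. w m (Poly_Mapping.lookup r m))"
    if "finite A" "Poly_Mapping.keys r \<subseteq> A" for r A
    unfolding pw_extend_def w_def[symmetric] using that
    by (intro sum.mono_neutral_left) (auto simp: w0 in_keys_iff)
  let ?A = "Poly_Mapping.keys p \<union> Poly_Mapping.keys q"
  have "Poly_Mapping.keys (p + q) \<subseteq> ?A"
    by (rule keys_add)
  then show ?thesis
    by (simp add: ext[of ?A] lookup_add w_add sum.distrib)
qed

end

theory Submission
  imports Defs
begin

text \<open>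
  Write \<open>F = I f\<close>. In the piecewise extension put \<open>H\<^sub>m\<close> for the basis element of an index
  \<open>m\<close>, so that \<open>H\<^sub>m = 1\<close> for the adjoined identity. The defining formulas for the integral of
  \<open>f\<close> and of \<open>f H\<^sub>a\<close> are one formula: if \<open>h\<^sub>m\<close> is the value of \<open>H\<^sub>m\<close> under the extended
  evaluation, that is at the origin, and \<open>\<epsilon>\<^sub>m\<close>
  is evaluation at the jump of \<open>H\<^sub>m\<close>, then
  \<open>\<integral> f H\<^sub>m = F H\<^sub>m - \<epsilon>\<^sub>m(F) (H\<^sub>m - h\<^sub>m)\<close>.
  For the identity, \<open>H\<^sub>m - h\<^sub>m = 0\<close>, so it does not matter which point is called its jump. For a step at \<open>a\<close>
  the formula uses \<open>\<epsilon>\<^sub>0(F) = 0\<close>, which gives \<open>\<integral>\<^sub>0\<^sup>a f = \<epsilon>\<^sub>a(F)\<close>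
  (lemma \<open>integral'_basis\<close>).

  The evaluation of the right-hand side at the origin is \<open>0 - \<epsilon>\<^sub>m(F) (h\<^sub>m - h\<^sub>m) = 0\<close>, because the
  extended evaluation is multiplicative; this rests on \<open>h\<^sub>m\<^sub>+\<^sub>n = h\<^sub>m h\<^sub>n\<close>. The commutator with a
  shift is compared in the same way, using that evaluation at \<open>a - c\<close> after a shift by \<open>c\<close> is
  evaluation at \<open>a\<close>.

  The Rota-Baxter identity is biadditive and symmetric, so it is enough to prove it for \<open>f H\<^sub>m\<close>
  and \<open>g H\<^sub>n\<close>; as the order is total, one index absorbs the other, say \<open>H\<^sub>m H\<^sub>n = H\<^sub>n\<close>, and then
  \<open>h\<^sub>m h\<^sub>n = h\<^sub>n\<close> as well. Two multiplicative maps, the embedding of the base algebra and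
  \<open>\<epsilon>\<^sub>n\<close>, turn the Rota-Baxter identity of the base algebra into two relations, and from these four
  relations the claim follows by commutative algebra (lemma \<open>rota_baxter_jump_identity\<close>).
\<close>

section \<open>Scalars in commutative algebras\<close>

lemma (in comm_algebra) scale_eq_mult: "scale c x = scale c 1 * x"
  by (simp add: scale_mult_left)

lemma (in comm_algebra) scale_one_mult: "scale (c * d) 1 = scale c 1 * scale d 1"
  by (simp add: scale_mult_left)

lemma (in algebra_hom) hom_scale_one: "h (scale1 k 1) = scale2 k 1"
  by (simp add: scale hom_one)

lemma algebra_homI:
  assumes "comm_algebra scale1" "comm_algebra scale2"
    and "\<And>x y. h (x + y) = h x + h y" "\<And>c x. h (scale1 c x) = scale2 c (h x)"
    and "\<And>x y. h (x * y) = h x * h y" "h 1 = 1"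
  shows "algebra_hom scale1 scale2 h"
proof -
  interpret s1: comm_algebra scale1 by fact
  interpret s2: comm_algebra scale2 by fact
  show ?thesis
    by unfold_locales (use assms in auto)
qed

section \<open>The free module underlying the piecewise extension\<close>

lemma pw_embed_add: "pw_embed (f + g) = pw_embed f + pw_embed g"
  by (simp add: pw_embed_def single_add)

lemma pw_embed_diff: "pw_embed (f - g) = pw_embed f - pw_embed g"
  by (simp add: pw_embed_def single_diff)

lemma pw_embed_mult: "pw_embed (f * g) = pw_embed f * pw_embed g"
  by (simp add: pw_embed_def mult_single)

lemma pw_embed_one: "pw_embed 1 = 1"
  by (simp add: pw_embed_def)

lemma inj_pw_embed: "inj pw_embed"
  unfolding pw_embed_def by (rule inj_single)

definition pw_basis :: "'k::linorder pw_index \<Rightarrow> ('k, 'f::comm_ring_1) piecewise" where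
  "pw_basis m = Poly_Mapping.single m 1"

lemma single_eq_embed_basis: "Poly_Mapping.single m f = pw_embed f * pw_basis m"
  by (simp add: pw_embed_def pw_basis_def mult_single)

lemma pw_basis_simps [simp]: "pw_basis Identity = 1" "pw_basis (Step a) = pw_step a"
  by (simp_all add: pw_basis_def pw_step_def flip: zero_pw_index_def)

lemma pw_basis_add: "pw_basis (m + n) = pw_basis m * pw_basis n"
  by (simp add: pw_basis_def mult_single)

lemma pw_basis_mult_embed:
  "(pw_embed f * pw_basis m) * (pw_embed g * pw_basis n) = pw_embed (f * g) * pw_basis (m + n)"
  by (simp add: pw_basis_add pw_embed_mult)

text \<open>The piecewise extension is spanned additively by the \<open>f H\<^sub>m\<close>; identities that are additive
  in an argument need only be checked there.\<close>

lemma piecewise_induct [case_names basis add]: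
  fixes p :: "('k::linorder, 'f::comm_ring_1) piecewise"
  assumes "\<And>f m. P (pw_embed f * pw_basis m)" "\<And>p q. P p \<Longrightarrow> P q \<Longrightarrow> P (p + q)"
  shows "P p"
proof (induction p rule: update_induct)
  case const
  show ?case using assms(1)[of 0 Identity] by (simp add: pw_embed_def)
next
  case (update p m f)
  have "Poly_Mapping.update m f p = p + pw_embed f * pw_basis m"
    unfolding single_eq_embed_basis[symmetric]
    by (rule poly_mapping_eqI)
      (use update.hyps in \<open>auto simp: lookup_update lookup_add lookup_single in_keys_iff when_def\<close>)
  then show ?case using assms update.IH by simp
qed

text \<open>Totality of the order enters here: of two indices, one absorbs the other.\<close>

lemma pw_index_add_absorb:
  fixes m n :: "'k::linorder pw_index"
  shows "m + n = n \<or> m + n = m"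
  by (cases m; cases n) (auto simp: max_def)

lemma pw_extend_basis:
  assumes "u 0 = 0" "\<And>a. v a 0 = 0"
  shows "pw_extend u v (pw_embed f * pw_basis m) = (case m of Identity \<Rightarrow> u f | Step a \<Rightarrow> v a f)"
  using assms by (cases m) (simp_all add: pw_extend_embed pw_extend_mult_step)

text \<open>The value \<open>h\<^sub>m\<close> of \<open>H\<^sub>m\<close> under the extended evaluation at the origin; a step located at the
  origin itself already counts as \<open>1\<close> there.\<close>

fun basis_at_zero :: "'k::linordered_field pw_index \<Rightarrow> 'k" where
  "basis_at_zero Identity = 1"
| "basis_at_zero (Step a) = heaviside_bar a"

lemma basis_at_zero_add: "basis_at_zero (m + n) = basis_at_zero m * basis_at_zero n"
  by (cases m; cases n) (auto simp: heaviside_bar_def heaviside_def max_def)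

fun shift_index :: "'k::linordered_field \<Rightarrow> 'k pw_index \<Rightarrow> 'k pw_index" where
  "shift_index c Identity = Identity"
| "shift_index c (Step a) = Step (a - c)"

lemma shift_index_add: "shift_index c (m + n) = shift_index c m + shift_index c n"
  by (cases m; cases n) (auto simp: max_def)

text \<open>The place where \<open>H\<^sub>m\<close> jumps. The constant \<open>1\<close> has no jump, and \<open>0\<close> is a default:
  evaluation at this point only occurs multiplied by \<open>H\<^sub>m - h\<^sub>m\<close>, which vanishes for \<open>H\<^sub>m = 1\<close>.\<close>

fun jump_point :: "'k::linordered_field pw_index \<Rightarrow> 'k" where
  "jump_point Identity = 0"
| "jump_point (Step a) = a"

section \<open>The ring identity behind the Rota-Baxter property\<close>

text \<open>Here \<open>x\<close> and \<open>y\<close> stand for \<open>H\<^sub>m\<close> and \<open>H\<^sub>n\<close>, and \<open>p\<close>, \<open>q\<close> for their values at the origin.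
  \<open>F\<close> and \<open>G\<close> are the integrals of \<open>f\<close> and \<open>g\<close>, and \<open>U\<close>, \<open>V\<close> those of \<open>f G\<close> and \<open>g F\<close>. Evaluation
  at the jump of \<open>H\<^sub>n\<close> takes \<open>F\<close>, \<open>G\<close>, \<open>U\<close>, \<open>V\<close> to \<open>\<gamma>\<close>, \<open>\<beta>\<close>, \<open>u\<close>, \<open>v\<close>, while \<open>\<alpha>\<close> is the value of
  \<open>F\<close> at the jump of \<open>H\<^sub>m\<close>. The first line on the right is the integral of \<open>f H\<^sub>m\<close> times
  that of \<open>g H\<^sub>n\<close>, expanded with \<open>x y = y\<close>; the second one arises in the same way
  from \<open>g H\<^sub>n\<close> times the integral of \<open>f H\<^sub>m\<close>. After \<open>V\<close> and \<open>v\<close>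
  are eliminated, both sides agree modulo the ideal generated by \<open>x y - y\<close> and \<open>p q - q\<close>.\<close>

lemma rota_baxter_jump_identity:
  fixes x y p q :: "'r::comm_ring_1"
  assumes xy: "x * y = y" and pq: "p * q = q"
  assumes FG: "F * G = U + V" and fg: "\<gamma> * \<beta> = u + v"
  shows "(F * x - \<alpha> * (x - p)) * (G * y - \<beta> * (y - q)) =
           ((U * y - u * (y - q)) - \<beta> * (F * y - \<gamma> * (y - q)) + \<beta> * q * (F * x - \<alpha> * (x - p))) +
           ((V * y - v * (y - q)) - \<alpha> * (1 - p) * (G * y - \<beta> * (y - q)))" (is "?lhs = ?rhs")
proof -
  have V: "V = F * G - U" and v: "v = \<gamma> * \<beta> - u"
    using FG fg by simp_all
  have "?lhs - ?rhs = (F - \<alpha>) * (G - \<beta>) * (x * y - y) - \<alpha> * \<beta> * (p * q - q)"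
    unfolding V v by (simp add: algebra_simps)
  then show ?thesis
    using xy pq by simp
qed

section \<open>Algebra structure, evaluation and shifts\<close>

locale piecewise_extension = shifted_rota_baxter scale I e S
  for scale :: "'k::linordered_field \<Rightarrow> 'f::comm_ring_1 \<Rightarrow> 'f"
    and I :: "'f \<Rightarrow> 'f" and e :: "'f \<Rightarrow> 'k" and S :: "'k \<Rightarrow> 'f \<Rightarrow> 'f"
begin

lemma integral_add: "I (f + g) = I f + I g" and integral_scale: "I (scale k f) = scale k (I f)"
  using rota_baxter.axioms(2)[OF rota_baxter_axioms] by (simp_all add: Vector_Spaces.linear_iff)

lemma eval_linear: "Vector_Spaces.linear scale (*) e"
  using algebra_hom.axioms(3)[OF character.axioms[OF character_axioms]] .

lemma eval_add: "e (f + g) = e f + e g" and eval_scale: "e (scale k f) = k * e f"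
  using eval_linear by (simp_all add: Vector_Spaces.linear_iff)

lemma eval_const: "e (scale k 1) = k"
  by (simp add: eval_scale hom_one)

sublocale shift: algebra_automorphism scale "S c" for c
  by (rule shift_automorphism)

text \<open>\<open>S\<^sub>0\<close> is idempotent by additivity and injective as an automorphism.\<close>

lemma shift_zero: "S 0 f = f"
proof -
  have "S 0 (S 0 f) = S 0 f"
    using shift_add[of 0 0] by (simp add: fun_eq_iff)
  then show ?thesis
    using shift.bij[of 0] by (simp add: bij_def inj_eq)
qed

lemma eval_at_zero: "eval_at e S 0 f = e f"
  by (simp add: eval_at_def shift_zero)

lemma eval_at_shift: "eval_at e S a (S c f) = eval_at e S (a + c) f"
  by (simp add: eval_at_def shift_add)

sublocale eval_at: character scale "eval_at e S c" for c
  unfolding character_def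
  by (rule algebra_homI)
    (unfold_locales, auto simp: eval_at_def eval_add eval_scale shift.add shift.scale
      hom_mult shift.hom_mult hom_one shift.hom_one algebra_simps)

lemma shift_integral: "I (S c f) = S c (I f) - scale (eval_at e S c (I f)) 1"
  using shift_commutator[of c f] by (simp add: algebra_simps)

abbreviation pw_const :: "'k \<Rightarrow> ('k, 'f) piecewise" where
  "pw_const k \<equiv> pw_embed (scale k 1)"

abbreviation integral' :: "('k, 'f) piecewise \<Rightarrow> ('k, 'f) piecewise" where
  "integral' \<equiv> pw_integral scale I e S"

lemma pw_const_add: "pw_const (k + l) = pw_const k + pw_const l"
  by (simp add: scale_left_distrib pw_embed_add)

lemma pw_const_diff: "pw_const (k - l) = pw_const k - pw_const l"
  by (simp add: scale_left_diff_distrib pw_embed_diff)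

lemma pw_const_mult: "pw_const (k * l) = pw_const k * pw_const l"
  by (subst scale_one_mult) (rule pw_embed_mult)

text \<open>Scaling is multiplication by an embedded constant. This turns linearity over the field into
  a statement about products, so that all later identities live in one commutative ring.\<close>

lemma pw_scale_eq_mult: "pw_scale scale k p = pw_const k * p"
proof -
  have "scale k = (*) (scale k 1)"
    using scale_eq_mult by blast
  then show ?thesis
    unfolding pw_scale_def pw_embed_def by (metis mult_map_scale_conv_mult)
qed

sublocale pw: comm_algebra "pw_scale scale"
  by unfold_locales
    (simp_all add: pw_scale_eq_mult pw_embed_add pw_const_mult pw_embed_one algebra_simps)

lemma pw_const_mult_basis:
  "pw_const k * (pw_embed f * pw_basis m) = pw_embed (scale k f) * pw_basis m"
  by (simp add: scale_eq_mult[of k f] pw_embed_mult mult.assoc)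

text \<open>Additive maps out of the piecewise extension are given by their values on the \<open>f H\<^sub>m\<close>, so
  homogeneity and multiplicativity can be read off there.\<close>

lemma basis_additive_imp_linear:
  assumes "\<And>p q. h (p + q) = h p + h q" "vector_space scale'"
    and "\<And>k f m. h (pw_embed (scale k f) * pw_basis m) = scale' k (h (pw_embed f * pw_basis m))"
  shows "Vector_Spaces.linear (pw_scale scale) scale' h"
proof -
  interpret t: vector_space scale' by fact
  have "h (pw_scale scale k p) = scale' k (h p)" for k p
    by (induction p rule: piecewise_induct)
      (simp_all add: assms pw_scale_eq_mult pw_const_mult_basis t.scale_right_distrib distrib_left)
  then show ?thesis
    unfolding Vector_Spaces.linear_iff using assms pw.vector_space_axioms by blast
qed

lemma basis_multiplicative:
  fixes h :: "('k, 'f) piecewise \<Rightarrow> 'r::comm_ring_1"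
  assumes "\<And>p q. h (p + q) = h p + h q"
    and "\<And>f g m n. h (pw_embed (f * g) * pw_basis (m + n)) =
           h (pw_embed f * pw_basis m) * h (pw_embed g * pw_basis n)"
  shows "h (p * q) = h p * h q"
proof (induction p rule: piecewise_induct)
  case (basis f m)
  show ?case
    by (induction q rule: piecewise_induct)
      (simp_all only: assms pw_basis_mult_embed distrib_left)
next
  case (add p q)
  then show ?case by (simp add: assms(1) distrib_right)
qed

lemma pw_eval_add: "pw_eval e (p + q) = pw_eval e p + pw_eval e q"
  unfolding pw_eval_def by (rule pw_extend_add) (simp_all add: eval_add algebra_simps)

lemma pw_eval_basis: "pw_eval e (pw_embed f * pw_basis m) = e f * basis_at_zero m"
  unfolding pw_eval_def by (subst pw_extend_basis) (auto split: pw_index.split)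

lemma pw_eval_embed: "pw_eval e (pw_embed f) = e f"
  using pw_eval_basis[of f Identity] by simp

lemma pw_eval_pw_basis: "pw_eval e (pw_basis m) = basis_at_zero m"
  using pw_eval_basis[of 1 m] by (simp add: pw_embed_one hom_one)

sublocale pw_eval: character "pw_scale scale" "pw_eval e"
  unfolding character_def algebra_hom_def algebra_hom_axioms_def
proof (intro conjI allI)
  show "Vector_Spaces.linear (pw_scale scale) (*) (pw_eval e)"
    by (rule basis_additive_imp_linear)
      (simp_all add: pw_eval_add pw_eval_basis eval_scale target.vector_space_axioms)
  show "pw_eval e (p * q) = pw_eval e p * pw_eval e q" for p q
    by (rule basis_multiplicative)
      (simp_all add: pw_eval_add pw_eval_basis hom_mult basis_at_zero_add)
  show "pw_eval e 1 = 1"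
    using pw_eval_embed[of 1] by (simp add: pw_embed_one hom_one)
qed unfold_locales

lemma pw_shift_add: "pw_shift S c (p + q) = pw_shift S c p + pw_shift S c q"
  unfolding pw_shift_def
  by (rule pw_extend_add) (simp_all add: shift.add pw_embed_add distrib_right, simp_all add: pw_embed_def)

lemma pw_shift_basis:
  "pw_shift S c (pw_embed f * pw_basis m) = pw_embed (S c f) * pw_basis (shift_index c m)"
  unfolding pw_shift_def
  by (subst pw_extend_basis) (auto split: pw_index.split simp: pw_embed_def)

lemma pw_shift_embed: "pw_shift S c (pw_embed f) = pw_embed (S c f)"
  using pw_shift_basis[of c f Identity] by simp

lemma pw_shift_pw_basis: "pw_shift S c (pw_basis m) = pw_basis (shift_index c m)"
  using pw_shift_basis[of c 1 m] by (simp add: pw_embed_one shift.hom_one)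

lemma pw_shift_hom: "algebra_hom (pw_scale scale) (pw_scale scale) (pw_shift S c)"
  unfolding algebra_hom_def algebra_hom_axioms_def
proof (intro conjI allI)
  show "Vector_Spaces.linear (pw_scale scale) (pw_scale scale) (pw_shift S c)"
    by (rule basis_additive_imp_linear)
      (simp_all add: pw_shift_add pw_shift_basis shift.scale pw_scale_eq_mult pw_const_mult_basis
        pw.vector_space_axioms)
  show "pw_shift S c (p * q) = pw_shift S c p * pw_shift S c q" for p q
    by (rule basis_multiplicative)
      (simp_all add: pw_shift_add pw_shift_basis shift.hom_mult shift_index_add pw_basis_mult_embed)
  show "pw_shift S c 1 = 1"
    using pw_shift_embed[of c 1] by (simp add: pw_embed_one shift.hom_one)
qed unfold_locales

lemma pw_shift_compose: "pw_shift S (c + d) p = pw_shift S c (pw_shift S d p)"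
proof (induction p rule: piecewise_induct)
  case (basis f m)
  show ?case
    by (cases m) (simp_all only: pw_shift_basis shift_add shift_index.simps o_apply diff_diff_eq add.commute)
qed (simp add: pw_shift_add)

lemma pw_shift_zero: "pw_shift S 0 p = p"
proof (induction p rule: piecewise_induct)
  case (basis f m)
  show ?case
    by (cases m) (simp_all only: pw_shift_basis shift_zero shift_index.simps diff_zero)
qed (simp add: pw_shift_add)

sublocale pw_shift: shift_map "pw_scale scale" "pw_shift S"
proof (intro shift_map.intro shift_map_axioms.intro)
  show "comm_algebra (pw_scale scale)"
    by (rule pw.comm_algebra_axioms)
  fix c d :: 'k
  have "bij (pw_shift S c)"
    by (rule o_bij[of "pw_shift S (- c)"]) (auto simp: fun_eq_iff pw_shift_zero simp flip: pw_shift_compose)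
  then show "algebra_automorphism (pw_scale scale) (pw_shift S c)"
    by (intro algebra_automorphism.intro algebra_automorphism_axioms.intro pw_shift_hom)
  show "pw_shift S (c + d) = pw_shift S c \<circ> pw_shift S d"
    by (simp add: fun_eq_iff pw_shift_compose)
qed

sublocale pw_shift: algebra_automorphism "pw_scale scale" "pw_shift S c" for c
  by (rule pw_shift.shift_automorphism)

section \<open>The integral\<close>

lemma integral_from_to_zero: "integral_from_to scale I e S 0 a f = eval_at e S a (I f)"
  by (simp add: integral_from_to_def integral_from_def eval_at_zero eval_integral)

lemma integral'_add: "integral' (p + q) = integral' p + integral' q"
  unfolding pw_integral_def
  by (rule pw_extend_add)
    (simp_all add: integral_from_to_zero integral_from_def integral_add eval_at.add
      pw_scale_eq_mult pw_embed_add pw_embed_diff scale_left_distrib pw_const_mult algebra_simps,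
     simp_all add: pw_embed_def)

text \<open>The two defining clauses of the integral merge, since for the adjoined identity the
  correction term is multiplied by \<open>1 - 1\<close>.\<close>

lemma integral'_basis:
  "integral' (pw_embed f * pw_basis m) =
     pw_embed (I f) * pw_basis m
     - pw_const (eval_at e S (jump_point m) (I f)) * (pw_basis m - pw_const (basis_at_zero m))"
proof (cases m)
  case Identity
  then show ?thesis
    unfolding pw_integral_def
    by (subst pw_extend_basis)
      (simp_all add: integral_from_to_zero integral_from_def pw_scale_eq_mult pw_embed_one,
       simp_all add: pw_embed_def)
next
  case (Step a)
  then show ?thesis
    unfolding pw_integral_def
    by (subst pw_extend_basis)
      (simp_all add: integral_from_to_zero integral_from_def pw_scale_eq_mult pw_const_mult
        pw_embed_diff algebra_simps, simp_all add: pw_embed_def)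
qed

lemma integral'_embed: "integral' (pw_embed f) = pw_embed (I f)"
  using integral'_basis[of f Identity] by (simp add: pw_embed_one)

sublocale pw_integral: Vector_Spaces.linear "pw_scale scale" "pw_scale scale" integral'
proof (rule basis_additive_imp_linear)
  fix k f and m :: "'k pw_index"
  show "integral' (pw_embed (scale k f) * pw_basis m)
      = pw_scale scale k (integral' (pw_embed f * pw_basis m))"
    unfolding integral'_basis integral_scale eval_at.scale pw_scale_eq_mult pw_const_mult
    unfolding pw_const_mult_basis[symmetric]
    by (simp add: algebra_simps)
qed (simp_all add: integral'_add pw.vector_space_axioms)

lemma integral'_const_mult: "integral' (pw_const k * p) = pw_const k * integral' p"
  using pw_integral.scale[of k p] by (simp add: pw_scale_eq_mult)

text \<open>Absorption is assumed in one direction only; the other direction is this one with the two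
  factors exchanged, because the identity is symmetric in them.\<close>

lemma rota_baxter_basis:
  fixes f g :: 'f and m n :: "'k pw_index"
  assumes mn: "m + n = n"
  defines "p \<equiv> pw_embed f * pw_basis m" and "q \<equiv> pw_embed g * pw_basis n"
  shows "integral' p * integral' q = integral' (p * integral' q) + integral' (q * integral' p)"
proof -
  let ?x = "pw_basis m :: ('k, 'f) piecewise" and ?y = "pw_basis n :: ('k, 'f) piecewise"
  let ?p = "pw_const (basis_at_zero m)" and ?q = "pw_const (basis_at_zero n)"
  let ?a = "eval_at e S (jump_point m) (I f)" and ?b = "eval_at e S (jump_point n) (I g)"
  \<comment> \<open>Absorption of indices passes to \<open>H\<^sub>m H\<^sub>n\<close> and, by evaluating, to their values at the origin.\<close>
  have xy: "?x * ?y = ?y"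
    using mn pw_basis_add by metis
  have pq: "?p * ?q = ?q"
    using mn basis_at_zero_add pw_const_mult by metis
  have 1: "p * integral' q =
      pw_embed (f * I g) * ?y - pw_const ?b * (pw_embed f * ?y) + pw_const ?b * (?q * p)"
  proof -
    have "p * integral' q = pw_embed f * pw_embed (I g) * (?x * ?y)
        - pw_const ?b * (pw_embed f * (?x * ?y)) + pw_const ?b * (?q * p)"
      unfolding p_def q_def integral'_basis by (simp add: algebra_simps)
    then show ?thesis by (simp only: xy pw_embed_mult)
  qed
  have 2: "q * integral' p =
      pw_embed (g * I f) * ?y - pw_const ?a * (q - ?p * q)"
  proof -
    have "q * integral' p = pw_embed g * pw_embed (I f) * (?x * ?y)
        - pw_const ?a * (pw_embed g * (?x * ?y) - ?p * q)"
      unfolding p_def q_def integral'_basis by (simp add: algebra_simps)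
    then show ?thesis by (simp only: xy pw_embed_mult q_def)
  qed
  \<comment> \<open>The identity of the base algebra, embedded, and its image under evaluation at the jump of \<open>H\<^sub>n\<close>.\<close>
  have F: "pw_embed (I f) * pw_embed (I g) = pw_embed (I (f * I g)) + pw_embed (I (g * I f))"
    by (simp add: rota_baxter pw_embed_add flip: pw_embed_mult)
  have E: "pw_const (eval_at e S (jump_point n) (I f)) * pw_const ?b =
      pw_const (eval_at e S (jump_point n) (I (f * I g)))
      + pw_const (eval_at e S (jump_point n) (I (g * I f)))"
    by (simp add: rota_baxter flip: pw_const_mult pw_const_add eval_at.hom_mult eval_at.add)
  show ?thesis
    unfolding 1 2 integral'_add pw_integral.diff integral'_const_mult
    unfolding p_def q_def integral'_basis
    using rota_baxter_jump_identity[OF xy pq F E, of "pw_const ?a"]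
    by (simp add: algebra_simps)
qed

lemma rota_baxter_piecewise:
  "integral' p * integral' q = integral' (p * integral' q) + integral' (q * integral' p)"
proof (induction p rule: piecewise_induct)
  case (basis f m)
  show ?case
  proof (induction q rule: piecewise_induct)
    case (basis g n)
    consider "m + n = n" | "n + m = m"
      using pw_index_add_absorb[of m n] by (auto simp: add.commute)
    then show ?case
      by cases (metis rota_baxter_basis, metis rota_baxter_basis mult.commute add.commute)
  qed (simp add: integral'_add algebra_simps)
qed (simp add: integral'_add algebra_simps)

lemma pw_eval_integral: "pw_eval e (integral' p) = 0"
proof (induction p rule: piecewise_induct)
  case (basis f m)
  show ?case
    unfolding integral'_basis
    by (simp add: pw_eval.diff pw_eval.hom_mult eval_const pw_eval_embed pw_eval_pw_basis
        eval_integral)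
qed (simp add: integral'_add pw_eval_add)

text \<open>On \<open>f H\<^sub>a\<close> both sides equal \<open>\<epsilon>\<^sub>a(F) (h\<^sub>a - h\<^sub>a\<^sub>-\<^sub>c) + \<epsilon>\<^sub>c(F) h\<^sub>a\<^sub>-\<^sub>c\<close>: shifting moves the jump from
  \<open>a\<close> to \<open>a - c\<close> but leaves the subtracted constant \<open>h\<^sub>a\<close> where it was, which accounts for the first
  term; the second one is what the commutator \<open>\<epsilon>\<^sub>c(F)\<close> of the base algebra contributes.\<close>

lemma pw_shift_commutator:
  "pw_shift S c (integral' p) - integral' (pw_shift S c p)
     = pw_const (eval_at (pw_eval e) (pw_shift S) c (integral' p))"
proof (induction p rule: piecewise_induct)
  case (basis f m)
  show ?case
  proof (cases m)
    case Identity
    then show ?thesis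
      by (simp add: integral'_embed pw_shift_embed pw_eval_embed shift_integral pw_embed_diff
          eval_at_def)
  next
    case (Step a)
    let ?y = "pw_step (a - c) :: ('k, 'f) piecewise"
    let ?ea = "eval_at e S a (I f)" and ?ec = "eval_at e S c (I f)"
    let ?h = "heaviside_bar a" and ?h' = "heaviside_bar (a - c)"
    have y: "pw_shift S c (pw_step a) = ?y" "pw_eval e ?y = ?h'"
      using pw_shift_pw_basis[of c "Step a"] pw_eval_pw_basis[of "Step (a - c)"] by simp_all
    have 1: "pw_shift S c (integral' (pw_embed f * pw_basis m)) =
        pw_embed (S c (I f)) * ?y - pw_const ?ea * (?y - pw_const ?h)"
      unfolding integral'_basis Step
      by (simp add: pw_shift.diff pw_shift.hom_mult pw_shift_embed y shift.hom_scale_one)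
    have "eval_at e S (a - c) (I (S c f)) = ?ea - ?ec"
      by (simp add: shift_integral eval_at.diff eval_at_shift eval_at.hom_scale_one)
    then have 2: "integral' (pw_shift S c (pw_embed f * pw_basis m)) =
        (pw_embed (S c (I f)) - pw_const ?ec) * ?y
        - (pw_const ?ea - pw_const ?ec) * (?y - pw_const ?h')"
      unfolding pw_shift_basis integral'_basis Step
      by (simp add: pw_const_diff shift_integral pw_embed_diff del: scale_left_diff_distrib)
    have "pw_eval e (pw_shift S c (integral' (pw_embed f * pw_basis m))) =
        ?ec * ?h' - ?ea * (?h' - ?h)"
      unfolding 1
      by (simp add: pw_eval.diff pw_eval.hom_mult pw_eval_embed y eval_const eval_at_def[of e])
    then have 3: "pw_const (eval_at (pw_eval e) (pw_shift S) c (integral' (pw_embed f * pw_basis m))) =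
        pw_const ?ec * pw_const ?h' - pw_const ?ea * (pw_const ?h' - pw_const ?h)"
      unfolding eval_at_def[of "pw_eval e"] o_apply by (simp only: pw_const_diff pw_const_mult)
    show ?thesis
      unfolding 1 2 3 by (simp only: left_diff_distrib right_diff_distrib) simp
  qed
next
  case (add p q)
  then show ?case
    by (simp add: eval_at_def integral'_add pw_shift_add pw_eval_add pw_embed_add algebra_simps)
qed

sublocale piecewise: shifted_rota_baxter "pw_scale scale" integral' "pw_eval e" "pw_shift S"
proof (intro shifted_rota_baxter.intro rb_evaluation.intro rota_baxter.intro
    rota_baxter_axioms.intro rb_evaluation_axioms.intro shifted_rota_baxter_axioms.intro)
  show "pw_shift S c (integral' p) - integral' (pw_shift S c p)
      = pw_scale scale (eval_at (pw_eval e) (pw_shift S) c (integral' p)) 1" for c p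
    by (simp add: pw_shift_commutator pw_scale_eq_mult)
qed (fact pw.comm_algebra_axioms pw_integral.linear_axioms rota_baxter_piecewise
    pw_eval.character_axioms pw_eval_integral pw_shift.shift_map_axioms)+

lemma pw_embed_hom: "algebra_hom scale (pw_scale scale) pw_embed"
proof (rule algebra_homI)
  show "pw_embed (scale k f) = pw_scale scale k (pw_embed f)" for k f
    unfolding pw_scale_eq_mult by (metis pw_embed_mult scale_eq_mult)
qed (fact comm_algebra_axioms pw.comm_algebra_axioms pw_embed_add pw_embed_mult pw_embed_one)+

lemma piecewise_extends:
  "shifted_rota_baxter_extension scale I e S
     (pw_scale scale) integral' (pw_eval e) (pw_shift S) pw_embed"
  by (intro shifted_rota_baxter_extension.intro shifted_rota_baxter_extension_axioms.intro
      shifted_rota_baxter_axioms piecewise.shifted_rota_baxter_axioms pw_embed_hom inj_pw_embed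
      integral'_embed pw_eval_embed pw_shift_embed)

end

theorem proposition4:
  fixes scale :: "'k::linordered_field \<Rightarrow> 'f::comm_ring_1 \<Rightarrow> 'f"
    and I :: "'f \<Rightarrow> 'f"
    and S :: "'k \<Rightarrow> 'f \<Rightarrow> 'f"
    and e :: "'f \<Rightarrow> 'k"
  assumes "ordinary_rota_baxter scale I"
    and "e = ordinary_eval scale I"
    and "shifted_rota_baxter scale I e S"
  shows "shifted_rota_baxter
           (pw_scale scale) (pw_integral scale I e S) (pw_eval e) (pw_shift S)
       \<and> shifted_rota_baxter_extension
           scale I e S
           (pw_scale scale) (pw_integral scale I e S) (pw_eval e) (pw_shift S)
           pw_embed"
proof -
  interpret piecewise_extension scale I e S
    by (rule piecewise_extension.intro) fact
  show ?thesis
    using piecewise.shifted_rota_baxter_axioms piecewise_extends by blast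
qed

end
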